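(* There are absolute constants $c,C>0$ such that the following holds. Let $\mathcal X\subseteq\mathbb R^d$ be a nonempty closed bounded convex set with diameter $D=\max_{x,y\in\mathcal X}\|x-y\|$. Let $F:\mathcal X\to\mathbb R^d$ be continuous, $L_1$-smooth, i.e. $\|\nabla F(x)-\nabla F(y)\|_{\mathrm{op}}\le L_1\|x-y\|$ for all $x,y\in\mathcal X$, and strongly monotone with constant $\mu>0$, i.e. $\langle F(x)-F(y),x-y\rangle\ge\mu\|x-y\|^2$ for all $x,y\in\mathcal X$. Let $\delta\ge0$ and let $J(v)$, $v\in\mathcal X$, be inexact Jacobians with $\|\nabla F(v)-J(v)\|\le\delta$. Let $x^*\in\mathcal X$ be the solution of the variational inequality $\langle F(x^* ),x-x^*\rangle\ge0$ for all $x\in\mathcal X$, and let $0<\varepsilon\le D$. Then the algorithm VIJI-Restarted (with constant $c$ in the inner iteration counts $T_i$) produces after $n=\lceil\log_2\frac D\varepsilon\rceil$ restarts a point $z_n$ with $\|z_n-x^*\|\le\varepsilon$, and the total number of VIJI iterations performed satisfies $$\sum_{i=1}^nT_i\le C\left(\left(\frac{L_1D}{\mu}\right)^{2/3}+\left(\frac\delta\mu+1\right)\left\lceil\log_2\frac D\varepsilon\right\rceil\right).$$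
   Context: $\|\cdot\|$ is the Euclidean norm (operator norm for matrices). Inexact model: for $v\in\mathcal X$ and $\eta>0$, $\Psi_v(x)=F(v)+J(v)[x-v]$ and $\Omega_v^\eta(x)=\Psi_v(x)+\eta\delta(x-v)+5L_1\|x-v\|(x-v)$. Algorithm VIJI: given $x_0\in\mathcal X$, $L_1$, $\delta$, $\eta$ and a sequence $\{\beta_k\}$, set $s_0=0\in\mathbb R^d$ and for $k=0,1,2,\dots$: (1) $v_{k+1}=\arg\max_{v\in\mathcal X}\{\langle s_k,v-x_0\rangle-\frac12\|v-x_0\|^2\}$; (2) $x_{k+1}\in\mathcal X$ is any point with $\sup_{x\in\mathcal X}\langle\Omega^\eta_{v_{k+1}}(x_{k+1}),x_{k+1}-x\rangle\le\frac{L_1}{2}\|x_{k+1}-v_{k+1}\|^3+\delta\|x_{k+1}-v_{k+1}\|^2$; (3) $\lambda_{k+1}$ is any number with $\frac1{32}\le\lambda_{k+1}\left(\frac{L_1}{2}\|x_{k+1}-v_{k+1}\|+\beta_{k+1}\right)\le\frac1{22}$; (4) $s_{k+1}=s_k-\lambda_{k+1}F(x_{k+1})$. With option $\mathsf{opt}=0$ the output after $T$ iterations is $\tilde x_T=\frac{1}{\sum_{k=1}^T\lambda_k}\sum_{k=1}^T\lambda_kx_k$. Algorithm VIJI-Restarted: given $z_0\in\mathcal X$, set $n=\lceil\log_2\frac D\varepsilon\rceil$, $R=D$; for $i=1,\dots,n$: set $R_{i-1}=R/2^{i-1}$, run VIJI from $x_0=z_{i-1}$ with $\beta_k=\delta$,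 $\eta=10$, $\mathsf{opt}=0$ for $$T_i=\left\lceil c\,\max\left\{\frac{L_1^{2/3}R_{i-1}^{2/3}}{\mu^{2/3}},\frac\delta\mu\right\}\right\rceil$$ iterations, and let $z_i$ be its output $\tilde x_{T_i}$. *)

theory Defs
  imports "HOL-Analysis.Analysis"
begin

text \<open>
  The theorem asserts the existence of constants that do not depend on the dimension \<open>d\<close>, so \<open>d\<close>
  has to be an ordinary natural number bound inside the scope of these constants and cannot be the
  cardinality of an index type. For every \<open>d\<close>, the Euclidean space of dimension \<open>d\<close> is realised
  as the subspace \<open>Rd d\<close> of one inner product space \<open>rvec\<close>, the finitely supported real sequences
  with the standard inner product; norm, topology, convexity and Frechet derivatives are those of
  the library's class \<^class>\<open>real_inner\<close>. Coordinates are numbered from 0.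
\<close>

typedef rvec = "{f :: nat \<Rightarrow> real. finite {i. f i \<noteq> 0}}"
  morphisms coord Abs_rvec
  by (rule exI[of _ "\<lambda>_. 0"]) simp

setup_lifting type_definition_rvec

lemma finite_coord: "finite {i. coord x i \<noteq> 0}"
  using coord[of x] by simp

lemma rvec_eqI: "(\<And>i. coord x i = coord y i) \<Longrightarrow> x = y"
  by (simp add: coord_inject[symmetric] fun_eq_iff)

instantiation rvec :: real_vector
begin

lift_definition zero_rvec :: rvec is "\<lambda>_. 0" by simp

lift_definition plus_rvec :: "rvec \<Rightarrow> rvec \<Rightarrow> rvec" is "\<lambda>f g i. f i + g i"
proof -
  fix f g :: "nat \<Rightarrow> real"
  assume "finite {i. f i \<noteq> 0}" "finite {i. g i \<noteq> 0}"
  then have "finite ({i. f i \<noteq> 0} \<union> {i. g i \<noteq> 0})"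
    by simp
  then show "finite {i. f i + g i \<noteq> 0}"
    by (rule rev_finite_subset) auto
qed

lift_definition minus_rvec :: "rvec \<Rightarrow> rvec \<Rightarrow> rvec" is "\<lambda>f g i. f i - g i"
proof -
  fix f g :: "nat \<Rightarrow> real"
  assume "finite {i. f i \<noteq> 0}" "finite {i. g i \<noteq> 0}"
  then have "finite ({i. f i \<noteq> 0} \<union> {i. g i \<noteq> 0})"
    by simp
  then show "finite {i. f i - g i \<noteq> 0}"
    by (rule rev_finite_subset) auto
qed

lift_definition uminus_rvec :: "rvec \<Rightarrow> rvec" is "\<lambda>f i. - f i" by simp

lift_definition scaleR_rvec :: "real \<Rightarrow> rvec \<Rightarrow> rvec" is "\<lambda>c f i. c * f i"
proof -
  fix c :: real and f :: "nat \<Rightarrow> real"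
  assume "finite {i. f i \<noteq> 0}"
  then show "finite {i. c * f i \<noteq> 0}"
    by (rule rev_finite_subset) auto
qed

lemmas coord_simps [simp] =
  zero_rvec.rep_eq plus_rvec.rep_eq minus_rvec.rep_eq uminus_rvec.rep_eq scaleR_rvec.rep_eq

instance
  by standard (rule rvec_eqI, simp add: distrib_left distrib_right)+

end

instantiation rvec :: real_inner
begin

definition inner_rvec :: "rvec \<Rightarrow> rvec \<Rightarrow> real" where
  "inner_rvec x y = (\<Sum>i | coord x i \<noteq> 0. coord x i * coord y i)"

definition norm_rvec :: "rvec \<Rightarrow> real" where
  "norm_rvec x = sqrt (inner x x)"

definition sgn_rvec :: "rvec \<Rightarrow> rvec" where
  "sgn_rvec x = x /\<^sub>R norm x"

definition dist_rvec :: "rvec \<Rightarrow> rvec \<Rightarrow> real" where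
  "dist_rvec x y = norm (x - y)"

definition uniformity_rvec :: "(rvec \<times> rvec) filter" where
  "uniformity_rvec = (INF e\<in>{0 <..}. principal {(x, y). dist x y < e})"

definition open_rvec :: "rvec set \<Rightarrow> bool" where
  "open_rvec U \<longleftrightarrow> (\<forall>x\<in>U. eventually (\<lambda>(x', y). x' = x \<longrightarrow> y \<in> U) uniformity)"

lemma inner_rvec_eq:
  assumes "finite A" "{i. coord x i \<noteq> 0} \<subseteq> A"
  shows "inner x y = (\<Sum>i\<in>A. coord x i * coord y i)"
  unfolding inner_rvec_def using assms by (intro sum.mono_neutral_left) auto

instance
proof
  fix x y z :: rvec and c :: real
  let ?S = "{i. coord x i \<noteq> 0} \<union> {i. coord y i \<noteq> 0}"
  have fin: "finite ?S"
    using finite_coord by simp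
  have "inner x y = (\<Sum>i\<in>?S. coord x i * coord y i)"
    "inner y x = (\<Sum>i\<in>?S. coord y i * coord x i)"
    by (rule inner_rvec_eq; use fin in auto)+
  then show "inner x y = inner y x"
    by (simp add: mult.commute)
  have "inner (x + y) z = (\<Sum>i\<in>?S. coord (x + y) i * coord z i)"
    "inner x z = (\<Sum>i\<in>?S. coord x i * coord z i)"
    "inner y z = (\<Sum>i\<in>?S. coord y i * coord z i)"
    by (rule inner_rvec_eq; use fin in auto)+
  then show "inner (x + y) z = inner x z + inner y z"
    by (simp add: algebra_simps sum.distrib)
  have "inner (c *\<^sub>R x) y = (\<Sum>i\<in>?S. coord (c *\<^sub>R x) i * coord y i)"
    "inner x y = (\<Sum>i\<in>?S. coord x i * coord y i)"
    by (rule inner_rvec_eq; use fin in auto)+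
  then show "inner (c *\<^sub>R x) y = c * inner x y"
    by (simp add: sum_distrib_left mult.assoc)
  show "0 \<le> inner x x"
    unfolding inner_rvec_def by (intro sum_nonneg) simp
  have "inner x x = 0 \<longleftrightarrow> (\<forall>i\<in>{i. coord x i \<noteq> 0}. coord x i * coord x i = 0)"
    unfolding inner_rvec_def by (intro sum_nonneg_eq_0_iff finite_coord) simp
  also have "\<dots> \<longleftrightarrow> (\<forall>i. coord x i = 0)"
    by auto
  also have "\<dots> \<longleftrightarrow> x = 0"
    using rvec_eqI[of x 0] by auto
  finally show "inner x x = 0 \<longleftrightarrow> x = 0" .
qed (simp_all add: norm_rvec_def sgn_rvec_def dist_rvec_def uniformity_rvec_def open_rvec_def)

end

definition Rd :: "nat \<Rightarrow> rvec set" where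
  "Rd d = {x. \<forall>i\<ge>d. coord x i = 0}"

lemma inner_Rd: "x \<in> Rd d \<Longrightarrow> inner x y = (\<Sum>i<d. coord x i * coord y i)"
  by (rule inner_rvec_eq) (auto simp: Rd_def, meson not_less)

lemma norm_Rd: "x \<in> Rd d \<Longrightarrow> norm x = sqrt (\<Sum>i<d. (coord x i)\<^sup>2)"
  by (simp add: norm_eq_sqrt_inner inner_Rd power2_eq_square)

text \<open>
  The product of the \<open>d\<close> by \<open>d\<close> matrix \<open>(A i j)\<close>, \<open>i, j < d\<close>, with the vector \<open>x\<close>. It ignores the
  coordinates of \<open>x\<close> from \<open>d\<close> on, so that \<^term>\<open>onorm (matvec d A)\<close>, a supremum over all of
  \<open>rvec\<close>, is the operator norm of the matrix.
\<close>

lift_definition matvec :: "nat \<Rightarrow> (nat \<Rightarrow> nat \<Rightarrow> real) \<Rightarrow> rvec \<Rightarrow> rvec" is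
  "\<lambda>d A f i. if i < d then (\<Sum>j<d. A i j * f j) else 0"
  by (rule finite_subset[of _ "{..<_}"]) auto

lemma coord_matvec: "coord (matvec d A x) i = (if i < d then (\<Sum>j<d. A i j * coord x j) else 0)"
  by transfer simp

lemma matvec_in_Rd: "matvec d A x \<in> Rd d"
  by (simp add: Rd_def coord_matvec)

lemma linear_matvec: "linear (matvec d A)"
proof (rule linearI; rule rvec_eqI)
  fix x y :: rvec and r :: real and i
  show "coord (matvec d A (x + y)) i = coord (matvec d A x + matvec d A y) i"
    by (simp add: coord_matvec distrib_left sum.distrib)
  show "coord (matvec d A (r *\<^sub>R x)) i = coord (r *\<^sub>R matvec d A x) i"
    by (simp add: coord_matvec sum_distrib_left mult.left_commute)
qed

lemma abs_coord_le_norm: "\<bar>coord x i\<bar> \<le> norm x"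
proof (cases "coord x i = 0")
  case False
  have "(coord x i)\<^sup>2 \<le> inner x x"
    unfolding inner_rvec_def power2_eq_square
    using False by (intro member_le_sum finite_coord) auto
  then show ?thesis
    by (simp add: norm_eq_sqrt_inner real_le_rsqrt)
qed simp

lemma bounded_linear_matvec: "bounded_linear (matvec d A)"
proof -
  have "norm (matvec d A x) \<le> norm x * (\<Sum>i<d. \<Sum>j<d. \<bar>A i j\<bar>)" for x
  proof -
    have "norm (matvec d A x) = L2_set (\<lambda>i. \<Sum>j<d. A i j * coord x j) {..<d}"
      by (simp add: norm_Rd[OF matvec_in_Rd] coord_matvec L2_set_def)
    also have "\<dots> \<le> (\<Sum>i<d. \<bar>\<Sum>j<d. A i j * coord x j\<bar>)"
      by (rule L2_set_le_sum_abs)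
    also have "\<dots> \<le> (\<Sum>i<d. \<Sum>j<d. \<bar>A i j\<bar> * norm x)"
      by (intro sum_mono order_trans[OF sum_abs] )
         (simp add: abs_mult mult_left_mono abs_coord_le_norm)
    finally show ?thesis
      by (simp add: sum_distrib_left mult.commute)
  qed
  then show ?thesis
    by (intro bounded_linear.intro bounded_linear_axioms.intro linear_matvec) blast
qed

definition matdiff_norm :: "nat \<Rightarrow> (nat \<Rightarrow> nat \<Rightarrow> real) \<Rightarrow> (nat \<Rightarrow> nat \<Rightarrow> real) \<Rightarrow> real" where
  "matdiff_norm d A B = onorm (matvec d (\<lambda>i j. A i j - B i j))"

definition Psi ::
  "nat \<Rightarrow> (rvec \<Rightarrow> rvec) \<Rightarrow> (rvec \<Rightarrow> nat \<Rightarrow> nat \<Rightarrow> real) \<Rightarrow> rvec \<Rightarrow> rvec \<Rightarrow> rvec" where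
  "Psi d F J v x = F v + matvec d (J v) (x - v)"

definition Omega ::
  "nat \<Rightarrow> (rvec \<Rightarrow> rvec) \<Rightarrow> (rvec \<Rightarrow> nat \<Rightarrow> nat \<Rightarrow> real) \<Rightarrow> real \<Rightarrow> real \<Rightarrow> real
    \<Rightarrow> rvec \<Rightarrow> rvec \<Rightarrow> rvec" where
  "Omega d F J L1 \<delta> \<eta> v x =
     Psi d F J v x + (\<eta> * \<delta>) *\<^sub>R (x - v) + (5 * L1 * norm (x - v)) *\<^sub>R (x - v)"

text \<open>
  The choices of \<open>x\<close> and \<open>lam\<close> in VIJI are not deterministic, so the algorithm is
  a relation: the sequences \<open>s\<close>, \<open>v\<close>, \<open>x\<close>, \<open>lam\<close> record a possible run of \<open>T\<close> iterations started
  at \<open>x0\<close>. The values \<open>v 0\<close>, \<open>x 0\<close> and \<open>lam 0\<close> are not used.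
\<close>

definition viji_run ::
  "nat \<Rightarrow> rvec set \<Rightarrow> (rvec \<Rightarrow> rvec) \<Rightarrow> (rvec \<Rightarrow> nat \<Rightarrow> nat \<Rightarrow> real) \<Rightarrow> real \<Rightarrow> real \<Rightarrow> real
    \<Rightarrow> (nat \<Rightarrow> real) \<Rightarrow> rvec \<Rightarrow> nat
    \<Rightarrow> (nat \<Rightarrow> rvec) \<Rightarrow> (nat \<Rightarrow> rvec) \<Rightarrow> (nat \<Rightarrow> rvec) \<Rightarrow> (nat \<Rightarrow> real) \<Rightarrow> bool" where
  "viji_run d X F J L1 \<delta> \<eta> \<beta> x0 T s v x lam \<longleftrightarrow>
     x0 \<in> X \<and> s 0 = 0 \<and>
     (\<forall>k<T.
        is_arg_max (\<lambda>w. inner (s k) (w - x0) - 1/2 * (norm (w - x0))\<^sup>2) (\<lambda>w. w \<in> X) (v (Suc k)) \<and>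
        x (Suc k) \<in> X \<and>
        (SUP y\<in>X. inner (Omega d F J L1 \<delta> \<eta> (v (Suc k)) (x (Suc k))) (x (Suc k) - y))
          \<le> L1 / 2 * norm (x (Suc k) - v (Suc k)) ^ 3 + \<delta> * (norm (x (Suc k) - v (Suc k)))\<^sup>2 \<and>
        1/32 \<le> lam (Suc k) * (L1 / 2 * norm (x (Suc k) - v (Suc k)) + \<beta> (Suc k)) \<and>
        lam (Suc k) * (L1 / 2 * norm (x (Suc k) - v (Suc k)) + \<beta> (Suc k)) \<le> 1/22 \<and>
        s (Suc k) = s k - lam (Suc k) *\<^sub>R F (x (Suc k)))"

text \<open>
  \<open>xt\<close> is a possible output of VIJI with option 0. For \<open>T = 0\<close> the weighted average is \<open>0/0\<close> and
  there is no output. (In the theorem, \<open>T = 0\<close> occurs only for \<open>L1 = \<delta> = 0\<close>, where the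
  rule for \<open>lam\<close> cannot be satisfied in any iteration either.)
\<close>

definition viji_output ::
  "nat \<Rightarrow> rvec set \<Rightarrow> (rvec \<Rightarrow> rvec) \<Rightarrow> (rvec \<Rightarrow> nat \<Rightarrow> nat \<Rightarrow> real) \<Rightarrow> real \<Rightarrow> real \<Rightarrow> real
    \<Rightarrow> (nat \<Rightarrow> real) \<Rightarrow> rvec \<Rightarrow> nat \<Rightarrow> rvec \<Rightarrow> bool" where
  "viji_output d X F J L1 \<delta> \<eta> \<beta> x0 T xt \<longleftrightarrow>
     T \<ge> 1 \<and>
     (\<exists>s v x lam. viji_run d X F J L1 \<delta> \<eta> \<beta> x0 T s v x lam \<and>
        xt = (1 / (\<Sum>k=1..T. lam k)) *\<^sub>R (\<Sum>k=1..T. lam k *\<^sub>R x k))"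

definition restart_count :: "real \<Rightarrow> real \<Rightarrow> nat" where
  "restart_count D \<epsilon> = nat \<lceil>log 2 (D / \<epsilon>)\<rceil>"

definition inner_iters :: "real \<Rightarrow> real \<Rightarrow> real \<Rightarrow> real \<Rightarrow> real \<Rightarrow> nat \<Rightarrow> nat" where
  "inner_iters c D L1 \<mu> \<delta> i =
     (let R = D / 2 ^ (i - 1) in
      nat \<lceil>c * max (L1 powr (2/3) * R powr (2/3) / \<mu> powr (2/3)) (\<delta> / \<mu>)\<rceil>)"

text \<open>
  \<open>z\<close> records a possible sequence \<open>z 0, \<dots>, z n\<close> of restart points of VIJI-Restarted, where
  \<open>n\<close> is \<^term>\<open>restart_count (diameter X) \<epsilon>\<close>.
\<close>

definition viji_restarted ::
  "real \<Rightarrow> nat \<Rightarrow> rvec set \<Rightarrow> (rvec \<Rightarrow> rvec) \<Rightarrow> (rvec \<Rightarrow> nat \<Rightarrow> nat \<Rightarrow> real) \<Rightarrow> real \<Rightarrow> real \<Rightarrow> real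
    \<Rightarrow> real \<Rightarrow> (nat \<Rightarrow> rvec) \<Rightarrow> bool" where
  "viji_restarted c d X F J L1 \<mu> \<delta> \<epsilon> z \<longleftrightarrow>
     z 0 \<in> X \<and>
     (\<forall>i\<in>{1..restart_count (diameter X) \<epsilon>}.
        viji_output d X F J L1 \<delta> 10 (\<lambda>_. \<delta>) (z (i - 1))
          (inner_iters c (diameter X) L1 \<mu> \<delta> i) (z i))"

end

theory Submission
  imports Defs
begin

text \<open>
  One run of VIJI from \<open>x0\<close> with \<open>norm (x0 - xstar) \<le> R\<close> and \<open>T\<close> iterations halves the distance to
  the solution, and restarting with the halved radius gives geometric convergence. The reason for
  the halving is an energy inequality. Write \<open>r\<^sub>k = norm (x\<^sub>k - v\<^sub>k)\<close>. The points \<open>v\<^sub>k\<close> are those of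
  dual averaging for the vectors \<open>lam\<^sub>k F(x\<^sub>k)\<close>, and strong concavity of the dual averaging objective
  leaves a term \<open>- norm (v\<^sub>k\<^sub>+\<^sub>1 - v\<^sub>k)\<^sup>2 / 2\<close> in every step (\<open>dual_averaging_regret\<close>). The regularised
  model \<open>\<Omega>\<close> at \<open>x\<^sub>k\<close> agrees with \<open>F(x\<^sub>k)\<close> up to \<open>A r\<^sub>k\<close> plus the regularisation \<open>10 A (x\<^sub>k - v\<^sub>k)\<close>,
  where \<open>A = L1 r\<^sub>k / 2 + \<delta>\<close>; as the step size keeps \<open>lam\<^sub>k A\<close> between 1/32 and 1/22, the
  regularisation pays for all errors and a surplus \<open>r\<^sub>k\<^sup>2 / 8\<close> remains
  (\<open>inexact_newton_step_gain\<close>). Altogether (\<open>viji_run_energy\<close>), for every \<open>u\<close> in \<open>X\<close>,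
  \<open>\<Sum>\<^sub>k lam\<^sub>k \<langle>F(x\<^sub>k), x\<^sub>k - u\<rangle> + \<Sum>\<^sub>k r\<^sub>k\<^sup>2 / 8 \<le> norm (u - x0)\<^sup>2 / 2\<close>.

  Take \<open>u = xstar\<close>. Strong monotonicity makes the first sum at least
  \<open>\<mu> \<Sum>\<^sub>k lam\<^sub>k norm (x\<^sub>k - xstar)\<^sup>2\<close>, so by Jensen's inequality the weighted mean of the \<open>x\<^sub>k\<close> is
  within \<open>R / sqrt (2 \<mu> \<Sum>\<^sub>k lam\<^sub>k)\<close> of \<open>xstar\<close>, and \<open>\<Sum>\<^sub>k lam\<^sub>k \<ge> 2 / \<mu>\<close> is enough for halving. The
  second sum gives \<open>\<Sum>\<^sub>k r\<^sub>k\<^sup>2 \<le> 4 R\<^sup>2\<close>: the displacements, hence the numbers \<open>A\<close>, are small on average,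
  and since \<open>lam\<^sub>k \<ge> 1 / (32 A)\<close> the steps are long on average. For \<open>T\<close> of the order of
  \<open>max ((L1 R / \<mu>) powr (2/3)) (\<delta> / \<mu>)\<close> they add up to \<open>2 / \<mu>\<close> (\<open>sum_step_sizes_ge\<close>).

  In the iteration count, the terms \<open>(L1 R\<^sub>i / \<mu>) powr (2/3)\<close> decay geometrically over the restarts, so
  that only \<open>\<delta> / \<mu>\<close> and the rounding are multiplied by the number of restarts.
\<close>

section \<open>First-order expansion over a convex set\<close>

lemma matdiff_norm_nonneg: "0 \<le> matdiff_norm d A B"
  unfolding matdiff_norm_def by (rule onorm_pos_le[OF bounded_linear_matvec])

lemma norm_matvec_diff_le:
  "norm (matvec d A h - matvec d B h) \<le> matdiff_norm d A B * norm h"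
proof -
  have "matvec d A h - matvec d B h = matvec d (\<lambda>i j. A i j - B i j) h"
    by (rule rvec_eqI) (simp add: coord_matvec left_diff_distrib sum_subtractf)
  then show ?thesis
    unfolding matdiff_norm_def using onorm[OF bounded_linear_matvec] by metis
qed

text \<open>
  Derivatives are taken within \<open>X\<close>, which may have empty interior, so everything happens on the
  segment from \<open>v\<close> to \<open>x\<close>: along it the linearisation error starts at 0 and has speed at most
  \<open>L t norm (x - v)\<^sup>2\<close> at time \<open>t\<close>.
\<close>

lemma norm_linearization_error_le:
  fixes F :: "'a::real_normed_vector \<Rightarrow> 'b::real_normed_vector"
  assumes "convex X" "v \<in> X" "x \<in> X"
    and deriv: "\<And>z. z \<in> X \<Longrightarrow> (F has_derivative F' z) (at z within X)"
    and lip: "\<And>z h. z \<in> X \<Longrightarrow> norm (F' z h - F' v h) \<le> L * norm (z - v) * norm h"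
  shows "norm (F x - F v - F' v (x - v)) \<le> L / 2 * (norm (x - v))\<^sup>2"
proof -
  define h where "h = x - v"
  define p where "p t = v + t *\<^sub>R h" for t :: real
  define g where "g t = F (p t) - t *\<^sub>R F' v h" for t
  have pX: "p t \<in> X" if "t \<in> {0..1}" for t
  proof -
    have "p t = (1 - t) *\<^sub>R v + t *\<^sub>R x"
      by (simp add: p_def h_def algebra_simps)
    then show ?thesis
      using convexD_alt[OF assms(1-3), of t] that by simp
  qed
  have gder: "(g has_vector_derivative (F' (p t) h - F' v h)) (at t within {0..1})"
    if "t \<in> {0..1}" for t
  proof -
    have "(p has_derivative (\<lambda>s. s *\<^sub>R h)) (at t within {0..1})"
      unfolding p_def by (auto intro!: derivative_eq_intros)
    moreover have "(F has_derivative F' (p t)) (at (p t) within p ` {0..1})"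
      by (rule has_derivative_subset[OF deriv[OF pX[OF that]]]) (use pX in auto)
    ultimately have "((\<lambda>s. F (p s)) has_derivative (\<lambda>s. F' (p t) (s *\<^sub>R h)))
        (at t within {0..1})"
      by (rule has_derivative_in_compose)
    moreover have "linear (F' (p t))"
      using deriv[OF pX[OF that]] has_derivative_linear by blast
    ultimately have "((\<lambda>s. F (p s)) has_vector_derivative F' (p t) h) (at t within {0..1})"
      by (simp add: has_vector_derivative_def linear_scale)
    then show ?thesis
      unfolding g_def by (auto intro!: derivative_eq_intros)
  qed
  define \<phi> where "\<phi> t = L / 2 * (norm h)\<^sup>2 * t\<^sup>2" for t
  have "norm (g 1 - g 0) \<le> \<phi> 1 - \<phi> 0"
  proof (rule differentiable_bound_general[where f' = "\<lambda>t. F' (p t) h - F' v h"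
        and \<phi>' = "\<lambda>t. L * (norm h)\<^sup>2 * t"])
    show "continuous_on {0..1} g"
      using gder by (meson continuous_on_vector_derivative)
    show "continuous_on {0..1} \<phi>"
      unfolding \<phi>_def by (intro continuous_intros)
    fix t :: real
    assume t: "0 < t" "t < 1"
    have at: "at t within {0..1} = at t"
      by (rule at_within_interior) (use t in simp)
    show "(g has_vector_derivative F' (p t) h - F' v h) (at t)"
      using gder[of t] t at by simp
    show "(\<phi> has_vector_derivative L * (norm h)\<^sup>2 * t) (at t)"
      unfolding \<phi>_def has_real_derivative_iff_has_vector_derivative[symmetric]
      by (auto intro!: derivative_eq_intros)
    have "norm (p t - v) = t * norm h"
      using t by (simp add: p_def)
    then show "norm (F' (p t) h - F' v h) \<le> L * (norm h)\<^sup>2 * t"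
      using lip[OF pX, of t h] t by (simp add: power2_eq_square algebra_simps)
  qed simp
  moreover have "g 1 - g 0 = F x - F v - F' v (x - v)"
    by (simp add: g_def p_def h_def)
  ultimately show ?thesis
    by (simp add: \<phi>_def h_def)
qed

section \<open>Dual averaging\<close>

text \<open>
  The objective is a quadratic with Hessian minus the identity, so it lies below its value at a
  maximiser by at least half the squared distance: the first-order term is nonpositive in every
  feasible direction.
\<close>

lemma arg_max_quadratic_gap:
  fixes X :: "'a::real_inner set"
  assumes "convex X"
    and v: "is_arg_max (\<lambda>w. inner s (w - x0) - 1/2 * (norm (w - x0))\<^sup>2) (\<lambda>w. w \<in> X) v"
    and u: "u \<in> X"
  shows "inner s (u - x0) - 1/2 * (norm (u - x0))\<^sup>2 + 1/2 * (norm (u - v))\<^sup>2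
    \<le> inner s (v - x0) - 1/2 * (norm (v - x0))\<^sup>2"
proof -
  define \<phi> where "\<phi> w = inner s (w - x0) - 1/2 * (norm (w - x0))\<^sup>2" for w
  define g where "g = inner (s - (v - x0)) (u - v)"
  define N where "N = (norm (u - v))\<^sup>2"
  have vX: "v \<in> X" and max: "\<And>w. w \<in> X \<Longrightarrow> \<phi> w \<le> \<phi> v"
    using v by (auto simp: is_arg_max_def \<phi>_def not_less)
  have expand: "\<phi> (v + t *\<^sub>R (u - v)) = \<phi> v + t * g - t\<^sup>2 / 2 * N" for t
    unfolding \<phi>_def g_def N_def power2_norm_eq_inner
    by (simp add: algebra_simps inner_commute power2_eq_square)
  have "g \<le> t / 2 * N" if t: "0 < t" "t < 1" for t
  proof -
    have "v + t *\<^sub>R (u - v) = (1 - t) *\<^sub>R v + t *\<^sub>R u"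
      by (simp add: algebra_simps)
    then have "v + t *\<^sub>R (u - v) \<in> X"
      using convexD_alt[OF assms(1) vX u, of t] t by simp
    from max[OF this] have "t * g \<le> t * (t / 2 * N)"
      by (simp add: expand power2_eq_square)
    then show ?thesis
      using t by simp
  qed
  moreover have "((\<lambda>t. t / 2 * N) \<longlongrightarrow> 0 / 2 * N) (at_right 0)"
    by (intro tendsto_intros) simp
  moreover have "eventually (\<lambda>t::real. 0 < t \<and> t < 1) (at_right 0)"
    using eventually_at_right_real[of 0 1] by simp
  ultimately have "g \<le> 0"
    by (intro tendsto_lowerbound[where F = "at_right 0" and f = "\<lambda>t. t / 2 * N" and x = 0])
       (auto elim: eventually_mono)
  then show ?thesis
    using expand[of 1] by (simp add: \<phi>_def N_def)
qed

text \<open>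
  Here \<open>b k\<close> bounds the error of step \<open>k\<close> uniformly over the possible next points \<open>w\<close>, so the
  next maximiser need not be known; this also covers the last step, after which no further point is
  computed.
\<close>

lemma dual_averaging_regret:
  fixes X :: "'a::real_inner set" and G :: "nat \<Rightarrow> 'a"
  assumes "convex X" "s 0 = 0"
    and step: "\<And>k. k < T \<Longrightarrow> s (Suc k) = s k - G (Suc k)"
    and v: "\<And>k. k < T \<Longrightarrow>
      is_arg_max (\<lambda>w. inner (s k) (w - x0) - 1/2 * (norm (w - x0))\<^sup>2) (\<lambda>w. w \<in> X) (v (Suc k))"
    and gain: "\<And>k w. k < T \<Longrightarrow> w \<in> X \<Longrightarrow>
      inner (G (Suc k)) (x (Suc k) - w) - 1/2 * (norm (w - v (Suc k)))\<^sup>2 \<le> b (Suc k)"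
    and "u \<in> X"
  shows "(\<Sum>k=1..T. inner (G k) (x k - u)) \<le> 1/2 * (norm (u - x0))\<^sup>2 + (\<Sum>k=1..T. b k)"
proof -
  \<comment> \<open>Stating the induction for all \<open>w\<close> in place of the maximiser avoids maximal values, which might
      not be attained after the last step.\<close>
  have main: "inner (s n) (w - x0) - 1/2 * (norm (w - x0))\<^sup>2
      + (\<Sum>k=1..n. inner (G k) (x k - x0)) \<le> (\<Sum>k=1..n. b k)" if "n \<le> T" "w \<in> X" for n w
    using that
  proof (induction n arbitrary: w)
    case 0
    then show ?case
      by (simp add: assms(2))
  next
    case (Suc n)
    then have n: "n < T" and vX: "v (Suc n) \<in> X"
      using v[of n] by (auto simp: is_arg_max_def)
    from arg_max_quadratic_gap[OF assms(1) v[OF n] Suc.prems(2)] Suc.IH[OF _ vX]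
      gain[OF n Suc.prems(2)] step[OF n] n
    show ?case
      by (simp add: inner_diff_left inner_diff_right)
  qed
  have sT: "s n = - (\<Sum>k=1..n. G k)" if "n \<le> T" for n
    using that by (induction n) (simp_all add: assms(2) step)
  have "(\<Sum>k=1..T. inner (G k) (x k - u))
      = (\<Sum>k=1..T. inner (G k) (x k - x0)) - (\<Sum>k=1..T. inner (G k) (u - x0))"
    unfolding sum_subtractf[symmetric] by (simp add: inner_diff_right)
  also have "(\<Sum>k=1..T. inner (G k) (u - x0)) = - inner (s T) (u - x0)"
    by (simp add: sT inner_sum_left)
  finally show ?thesis
    using main[of T u] \<open>u \<in> X\<close> by simp
qed

section \<open>Weighted means and harmonic sums\<close>

text \<open>
  Jensen's inequality for the squared norm, from its tangent at the mean \<open>m\<close>: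
  \<open>norm p\<^sup>2 \<ge> 2 \<langle>p, q\<rangle> - norm q\<^sup>2\<close> with \<open>p = x i - u\<close> and \<open>q = m - u\<close>.
\<close>

lemma sum_weights_norm_mean_le:
  fixes x :: "'b \<Rightarrow> 'a::real_inner"
  assumes "\<And>i. i \<in> I \<Longrightarrow> 0 \<le> w i" "0 < sum w I"
  shows "sum w I * (norm ((1 / sum w I) *\<^sub>R (\<Sum>i\<in>I. w i *\<^sub>R x i) - u))\<^sup>2
    \<le> (\<Sum>i\<in>I. w i * (norm (x i - u))\<^sup>2)"
proof -
  define m where "m = (1 / sum w I) *\<^sub>R (\<Sum>i\<in>I. w i *\<^sub>R x i)"
  have m: "(\<Sum>i\<in>I. w i *\<^sub>R x i) = sum w I *\<^sub>R m"
    using assms(2) by (simp add: m_def)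
  have "0 \<le> (norm ((x i - u) - (m - u)))\<^sup>2" for i
    by simp
  then have *: "2 * inner (x i - u) (m - u) - (norm (m - u))\<^sup>2 \<le> (norm (x i - u))\<^sup>2" for i
    by (simp only: power2_norm_eq_inner inner_diff inner_commute) (simp add: algebra_simps)
  have "(\<Sum>i\<in>I. w i *\<^sub>R (x i - u)) = sum w I *\<^sub>R (m - u)"
    by (simp add: scaleR_diff_right sum_subtractf m flip: scaleR_sum_left)
  then have "(\<Sum>i\<in>I. w i * inner (x i - u) (m - u)) = sum w I * (norm (m - u))\<^sup>2"
    by (simp add: power2_norm_eq_inner flip: inner_scaleR_left inner_sum_left)
  then have "sum w I * (norm (m - u))\<^sup>2
      = 2 * (\<Sum>i\<in>I. w i * inner (x i - u) (m - u)) - (\<Sum>i\<in>I. w i * (norm (m - u))\<^sup>2)"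
    by (simp add: sum_distrib_right)
  also have "\<dots> = (\<Sum>i\<in>I. w i * (2 * inner (x i - u) (m - u) - (norm (m - u))\<^sup>2))"
    by (simp add: right_diff_distrib sum_subtractf sum_distrib_left mult.left_commute)
  also have "\<dots> \<le> (\<Sum>i\<in>I. w i * (norm (x i - u))\<^sup>2)"
    by (intro sum_mono mult_left_mono * assms)
  finally show ?thesis
    by (simp add: m_def)
qed

text \<open>
  A form of the inequality between the arithmetic and the harmonic mean, by comparing \<open>1 / a\<close> with its
  tangent at \<open>b\<close>.
\<close>

lemma inverse_sum_lower_bound:
  fixes a :: "'b \<Rightarrow> real" and b :: real
  assumes "\<And>i. i \<in> I \<Longrightarrow> 0 < a i" "0 < b" "sum a I \<le> b * card I"
  shows "card I / b \<le> (\<Sum>i\<in>I. 1 / a i)"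
proof -
  have "2 / b - a i / b\<^sup>2 \<le> 1 / a i" if "i \<in> I" for i
  proof -
    have "0 \<le> (b - a i)\<^sup>2 / (a i * b\<^sup>2)"
      using assms(1)[OF that] by simp
    also have "\<dots> = 1 / a i - (2 / b - a i / b\<^sup>2)"
      using assms(1)[OF that] assms(2) by (simp add: field_simps power2_eq_square)
    finally show ?thesis by simp
  qed
  then have "(\<Sum>i\<in>I. 2 / b - a i / b\<^sup>2) \<le> (\<Sum>i\<in>I. 1 / a i)"
    by (rule sum_mono)
  moreover have "(\<Sum>i\<in>I. 2 / b - a i / b\<^sup>2) = 2 * card I / b - sum a I / b\<^sup>2"
    by (simp add: sum_subtractf sum_divide_distrib)
  moreover have "sum a I / b\<^sup>2 \<le> card I / b"
    using assms(2,3) by (simp add: field_simps power2_eq_square)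
  ultimately show ?thesis by simp
qed

section \<open>The energy inequality for VIJI\<close>

text \<open>
  With \<open>A = L / 2 * r + \<delta>\<close> all contributions scale with \<open>A\<close>: the tolerance of the subproblem is
  \<open>A r\<^sup>2\<close>, the model error is \<open>A r\<close>, and the choices \<open>\<eta> = 10\<close> and \<open>5 L\<close> make the regularisation
  exactly \<open>10 A (x - v)\<close>. With \<open>q = norm (w - v)\<close> this leaves
  \<open>\<langle>f, x - w\<rangle> \<le> A (11 r q - 8 r\<^sup>2)\<close>. The window for \<open>lam * A\<close> turns it into \<open>r q / 2 - r\<^sup>2 / 4\<close>, and
  the term \<open>- q\<^sup>2 / 2\<close> of dual averaging absorbs \<open>r q / 2\<close> at the price of \<open>r\<^sup>2 / 8\<close>.
\<close>

lemma inexact_newton_step_gain: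
  fixes x v w f \<psi> \<omega> :: "'a::real_inner" and L \<delta> lam :: real
  defines "r \<equiv> norm (x - v)"
  assumes nonneg: "0 \<le> L" "0 \<le> \<delta>"
    and \<omega>: "\<omega> = \<psi> + (10 * \<delta>) *\<^sub>R (x - v) + (5 * L * r) *\<^sub>R (x - v)"
    and err: "norm (f - \<psi>) \<le> L / 2 * r\<^sup>2 + \<delta> * r"
    and gap: "inner \<omega> (x - w) \<le> L / 2 * r ^ 3 + \<delta> * r\<^sup>2"
    and lam: "1/32 \<le> lam * (L / 2 * r + \<delta>)" "lam * (L / 2 * r + \<delta>) \<le> 1/22"
  shows "inner (lam *\<^sub>R f) (x - w) - 1/2 * (norm (w - v))\<^sup>2 \<le> - (r\<^sup>2 / 8)"
proof -
  define A where "A = L / 2 * r + \<delta>"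
  define q where "q = norm (w - v)"
  have r: "0 \<le> r" and q: "0 \<le> q" and A: "0 \<le> A"
    using nonneg by (simp_all add: r_def q_def A_def)
  have "0 < lam * A"
    using lam by (simp add: A_def)
  then have lam0: "0 < lam"
    using A by (simp add: zero_less_mult_iff)
  have "norm (x - w) \<le> r + q"
    using norm_triangle_ineq4[of "x - v" "w - v"] by (simp add: r_def q_def)
  moreover have "norm (f - \<psi>) \<le> A * r"
    using err by (simp add: A_def power2_eq_square algebra_simps)
  ultimately have "norm (f - \<psi>) * norm (x - w) \<le> A * r * (r + q)"
    using A r by (intro mult_mono) auto
  then have 1: "inner (f - \<psi>) (x - w) \<le> A * r * (r + q)"
    using norm_cauchy_schwarz order_trans by blast
  have "inner (x - v) (w - v) \<le> r * q"
    unfolding r_def q_def by (rule norm_cauchy_schwarz)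
  moreover have "inner (x - v) (x - w) = r\<^sup>2 - inner (x - v) (w - v)"
    unfolding r_def power2_norm_eq_inner by (simp add: inner_diff_right)
  ultimately have "A * (r\<^sup>2 - r * q) \<le> A * inner (x - v) (x - w)"
    using A by (intro mult_left_mono) auto
  moreover have "\<omega> = f - (f - \<psi>) + (10 * A) *\<^sub>R (x - v)"
    by (simp add: \<omega> A_def algebra_simps)
  then have "inner f (x - w) = inner \<omega> (x - w) + inner (f - \<psi>) (x - w)
      - 10 * (A * inner (x - v) (x - w))"
    by (simp add: inner_add_left inner_diff_left)
  moreover have "inner \<omega> (x - w) \<le> A * r\<^sup>2"
    using gap by (simp add: A_def power2_eq_square power3_eq_cube algebra_simps)
  ultimately have "inner f (x - w) \<le> A * (11 * (r * q) - 8 * r\<^sup>2)"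
    using 1 by (simp add: algebra_simps power2_eq_square)
  then have "lam * inner f (x - w) \<le> lam * (A * (11 * (r * q) - 8 * r\<^sup>2))"
    using lam0 by (intro mult_left_mono) auto
  also have "\<dots> = 11 * (lam * A * (r * q)) - 8 * (lam * A * r\<^sup>2)"
    by (simp add: algebra_simps)
  also have "\<dots> \<le> 11 * (1/22 * (r * q)) - 8 * (1/32 * r\<^sup>2)"
    using lam r q by (intro diff_mono mult_left_mono mult_right_mono) (auto simp: A_def)
  also have "\<dots> \<le> q\<^sup>2 / 2 - r\<^sup>2 / 8"
    using zero_le_power2[of "q - r / 2"] by (simp add: power2_eq_square algebra_simps)
  finally show ?thesis
    by (simp add: q_def)
qed

locale inexact_smooth_vi =
  fixes d :: nat and X :: "rvec set" and F :: "rvec \<Rightarrow> rvec"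
    and DF J :: "rvec \<Rightarrow> nat \<Rightarrow> nat \<Rightarrow> real" and L1 \<delta> :: real
  assumes convex_X: "convex X" and bounded_X: "bounded X"
    and deriv: "\<And>x. x \<in> X \<Longrightarrow> (F has_derivative matvec d (DF x)) (at x within X)"
    and smooth: "\<And>x y. x \<in> X \<Longrightarrow> y \<in> X \<Longrightarrow> matdiff_norm d (DF x) (DF y) \<le> L1 * norm (x - y)"
    and inexact: "\<And>v. v \<in> X \<Longrightarrow> matdiff_norm d (DF v) (J v) \<le> \<delta>"
    and nonneg: "0 \<le> L1" "0 \<le> \<delta>"
begin

lemma norm_F_minus_Psi_le:
  assumes v: "v \<in> X" and x: "x \<in> X"
  shows "norm (F x - Psi d F J v x) \<le> L1 / 2 * (norm (x - v))\<^sup>2 + \<delta> * norm (x - v)"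
proof -
  have "norm (F x - F v - matvec d (DF v) (x - v)) \<le> L1 / 2 * (norm (x - v))\<^sup>2"
  proof (rule norm_linearization_error_le[OF convex_X v x deriv])
    show "norm (matvec d (DF z) h - matvec d (DF v) h) \<le> L1 * norm (z - v) * norm h"
      if "z \<in> X" for z h
      using norm_matvec_diff_le mult_right_mono[OF smooth[OF that v] norm_ge_zero]
      by (rule order_trans)
  qed
  moreover have "norm (matvec d (DF v) (x - v) - matvec d (J v) (x - v)) \<le> \<delta> * norm (x - v)"
    using norm_matvec_diff_le mult_right_mono[OF inexact[OF v] norm_ge_zero]
    by (rule order_trans)
  moreover have "F x - Psi d F J v x = (F x - F v - matvec d (DF v) (x - v))
      + (matvec d (DF v) (x - v) - matvec d (J v) (x - v))"
    by (simp add: Psi_def)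
  ultimately show ?thesis
    using norm_triangle_le by (smt (verit))
qed

lemma viji_run_energy:
  assumes run: "viji_run d X F J L1 \<delta> 10 (\<lambda>_. \<delta>) x0 T s v x lam" and u: "u \<in> X"
  shows "(\<Sum>k=1..T. lam k * inner (F (x k)) (x k - u)) + (\<Sum>k=1..T. (norm (x k - v k))\<^sup>2) / 8
    \<le> (norm (u - x0))\<^sup>2 / 2"
proof -
  note run = run[unfolded viji_run_def]
  have "(\<Sum>k=1..T. inner (lam k *\<^sub>R F (x k)) (x k - u))
      \<le> 1/2 * (norm (u - x0))\<^sup>2 + (\<Sum>k=1..T. - ((norm (x k - v k))\<^sup>2 / 8))"
  proof (rule dual_averaging_regret[where s = s and v = v, OF convex_X _ _ _ _ u])
    fix k w
    assume k: "k < T" and w: "w \<in> X"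
    let ?x = "x (Suc k)" and ?v = "v (Suc k)"
    let ?\<omega> = "Omega d F J L1 \<delta> 10 ?v ?x"
    have x: "?x \<in> X" and v: "?v \<in> X"
      using run k by (auto simp: is_arg_max_def)
    show "inner (lam (Suc k) *\<^sub>R F ?x) (?x - w) - 1/2 * (norm (w - ?v))\<^sup>2
        \<le> - ((norm (?x - ?v))\<^sup>2 / 8)"
    proof (rule inexact_newton_step_gain[OF nonneg _ norm_F_minus_Psi_le[OF v x]])
      show "?\<omega> = Psi d F J ?v ?x + (10 * \<delta>) *\<^sub>R (?x - ?v) + (5 * L1 * norm (?x - ?v)) *\<^sub>R (?x - ?v)"
        by (simp add: Omega_def)
      \<comment> \<open>The supremum over \<open>X\<close> dominates each of its values only because the values are bounded.\<close>
      have "bounded ((\<lambda>y. inner ?\<omega> (?x - y)) ` X)"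
      proof -
        obtain B where B: "\<And>y. y \<in> X \<Longrightarrow> norm y \<le> B"
          using bounded_X by (auto simp: bounded_iff)
        have "norm (inner ?\<omega> (?x - y)) \<le> norm ?\<omega> * (norm ?x + B)" if "y \<in> X" for y
        proof -
          have "norm (?x - y) \<le> norm ?x + B"
            using norm_triangle_ineq4[of ?x y] B[OF that] by linarith
          then show ?thesis
            unfolding real_norm_def
            by (intro order_trans[OF Cauchy_Schwarz_ineq2] mult_left_mono norm_ge_zero)
        qed
        then show ?thesis
          unfolding bounded_iff by blast
      qed
      then have "inner ?\<omega> (?x - w) \<le> (SUP y\<in>X. inner ?\<omega> (?x - y))"
        by (intro cSUP_upper w bounded_imp_bdd_above)
      then show "inner ?\<omega> (?x - w) \<le> L1 / 2 * norm (?x - ?v) ^ 3 + \<delta> * (norm (?x - ?v))\<^sup>2"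
        using run k by force
    qed (use run k in auto)
  qed (use run in auto)
  then show ?thesis
    by (simp add: sum_negf sum_divide_distrib)
qed

end

section \<open>Halving the distance to the solution\<close>

locale strongly_monotone_vi = inexact_smooth_vi +
  fixes \<mu> :: real and xstar :: rvec
  assumes mu_pos: "0 < \<mu>"
    and strong_mono:
      "\<And>x y. x \<in> X \<Longrightarrow> y \<in> X \<Longrightarrow> \<mu> * (norm (x - y))\<^sup>2 \<le> inner (F x - F y) (x - y)"
    and xstar: "xstar \<in> X" and solution: "\<And>x. x \<in> X \<Longrightarrow> 0 \<le> inner (F xstar) (x - xstar)"
begin

text \<open>
  As \<open>lam k \<ge> 1 / (32 * a k)\<close>, where \<open>a k = L1 / 2 * norm (x k - v k) + \<delta>\<close>, it suffices that the
  average of the \<open>a k\<close> is at most \<open>\<mu> T / 64\<close>. By the Cauchy-Schwarz inequality the bound on the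
  squared displacements limits the average to \<open>L1 R / sqrt T + \<delta>\<close>, and the two lower bounds on \<open>T\<close>
  make each summand at most \<open>\<mu> T / 128\<close>.
\<close>

lemma sum_step_sizes_ge:
  assumes run: "viji_run d X F J L1 \<delta> 10 (\<lambda>_. \<delta>) x0 T s v x lam"
    and T: "0 < T" "128 * (L1 * R / \<mu>) powr (2/3) \<le> T" "128 * (\<delta> / \<mu>) \<le> T"
    and R: "0 \<le> R" and energy: "(\<Sum>k=1..T. (norm (x k - v k))\<^sup>2) \<le> 4 * R\<^sup>2"
  shows "2 / \<mu> \<le> (\<Sum>k=1..T. lam k)"
proof -
  define a where "a k = L1 / 2 * norm (x k - v k) + \<delta>" for k
  define b where "b = \<mu> * T / 64"
  have la: "1/32 \<le> lam k * a k" if "k \<in> {1..T}" for k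
  proof -
    obtain j where "k = Suc j" "j < T"
      using \<open>k \<in> {1..T}\<close> by (cases k) auto
    then show ?thesis
      using run by (simp add: viji_run_def a_def)
  qed
  have a_pos: "0 < a k" if "k \<in> {1..T}" for k
    using la[OF that] nonneg by (cases "a k = 0") (auto simp: a_def less_le)
  have sumr: "(\<Sum>k=1..T. norm (x k - v k)) \<le> 2 * R * sqrt T"
  proof (rule power2_le_imp_le)
    have "(\<Sum>k=1..T. norm (x k - v k))\<^sup>2 \<le> (\<Sum>k=1..T. (norm (x k - v k))\<^sup>2) * T"
      using sum_squared_le_sum_of_squares[of "\<lambda>k. norm (x k - v k)" "{1..T}"] by simp
    also have "\<dots> \<le> 4 * R\<^sup>2 * T"
      using energy by (intro mult_right_mono) auto
    finally show "(\<Sum>k=1..T. norm (x k - v k))\<^sup>2 \<le> (2 * R * sqrt T)\<^sup>2"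
      by (simp add: power_mult_distrib)
  qed (use R in simp)
  have smooth_part: "L1 * R * sqrt T \<le> \<mu> * (real T)\<^sup>2 / 128"
  proof -
    define q where "q = L1 * R / \<mu>"
    have q: "0 \<le> q"
      using nonneg R mu_pos by (simp add: q_def)
    \<comment> \<open>Cubing the hypothesis \<open>128 * q powr (2/3) \<le> T\<close> removes the fractional power; the goal
        \<open>128 * q * sqrt T \<le> T\<^sup>2\<close> is then compared after squaring.\<close>
    have "(q powr (2/3)) ^ 3 = q\<^sup>2"
      using q by (cases "q = 0") (simp_all add: powr_power)
    then have "128 ^ 3 * q\<^sup>2 = (128 * q powr (2/3)) ^ 3"
      by (simp add: power_mult_distrib)
    also have "\<dots> \<le> real T ^ 3"
      using T(2) by (intro power_mono) (simp_all add: q_def)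
    finally have cubes: "128 ^ 3 * q\<^sup>2 \<le> real T ^ 3" .
    have "128\<^sup>2 * q\<^sup>2 \<le> 128 ^ 3 * q\<^sup>2"
      by (intro mult_right_mono) simp_all
    with cubes have "(128\<^sup>2 * q\<^sup>2) * T \<le> real T ^ 3 * T"
      by (intro mult_right_mono) linarith+
    then have "(128 * q * sqrt T)\<^sup>2 \<le> ((real T)\<^sup>2)\<^sup>2"
      by (simp add: power_mult_distrib flip: power_add power_Suc2)
    then have "128 * q * sqrt T \<le> (real T)\<^sup>2"
      by (rule power2_le_imp_le) simp
    then show ?thesis
      using mu_pos by (simp add: q_def field_simps)
  qed
  have "sum a {1..T} = L1 / 2 * (\<Sum>k=1..T. norm (x k - v k)) + \<delta> * T"
    by (simp add: a_def sum.distrib sum_distrib_left)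
  also have "\<dots> \<le> L1 / 2 * (2 * R * sqrt T) + \<delta> * T"
    using sumr nonneg by (intro add_right_mono mult_left_mono) auto
  also have "\<dots> \<le> \<mu> * (real T)\<^sup>2 / 128 + \<mu> * T / 128 * T"
    using smooth_part T(3) mu_pos by (intro add_mono mult_right_mono) (auto simp: field_simps)
  also have "\<dots> = b * card {1..T}"
    by (simp add: b_def power2_eq_square)
  finally have "card {1..T} / b \<le> (\<Sum>k=1..T. 1 / a k)"
    using a_pos mu_pos T(1) by (intro inverse_sum_lower_bound) (auto simp: b_def)
  also have "\<dots> \<le> (\<Sum>k=1..T. 32 * lam k)"
    using la a_pos by (intro sum_mono) (simp add: field_simps)
  finally show ?thesis
    using T(1) by (simp add: b_def sum_distrib_left[symmetric])
qed

lemma viji_output_halves_distance: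
  assumes out: "viji_output d X F J L1 \<delta> 10 (\<lambda>_. \<delta>) x0 T xt"
    and T: "128 * (L1 * R / \<mu>) powr (2/3) \<le> T" "128 * (\<delta> / \<mu>) \<le> T"
    and R: "norm (x0 - xstar) \<le> R"
  shows "norm (xt - xstar) \<le> R / 2"
proof -
  from out obtain s v x lam
    where T0: "0 < T" and run: "viji_run d X F J L1 \<delta> 10 (\<lambda>_. \<delta>) x0 T s v x lam"
      and xt: "xt = (1 / sum lam {1..T}) *\<^sub>R (\<Sum>k=1..T. lam k *\<^sub>R x k)"
    by (auto simp: viji_output_def)
  have R0: "0 \<le> R"
    using R norm_ge_zero order_trans by blast
  have xX: "x k \<in> X" and lam_pos: "0 < lam k" if "k \<in> {1..T}" for k
  proof -
    obtain j where "k = Suc j" "j < T"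
      using \<open>k \<in> {1..T}\<close> by (cases k) auto
    then have "x k \<in> X" "0 < lam k * (L1 / 2 * norm (x k - v k) + \<delta>)"
      using run by (fastforce simp: viji_run_def)+
    moreover have "0 \<le> L1 / 2 * norm (x k - v k) + \<delta>"
      using nonneg by simp
    ultimately show "x k \<in> X" "0 < lam k"
      by (auto simp: zero_less_mult_iff)
  qed
  have mono: "\<mu> * (norm (x k - xstar))\<^sup>2 \<le> inner (F (x k)) (x k - xstar)" if "k \<in> {1..T}" for k
    using strong_mono[OF xX[OF that] xstar] solution[OF xX[OF that]] by (simp add: inner_diff_left)
  have mono': "\<mu> * (\<Sum>k=1..T. lam k * (norm (x k - xstar))\<^sup>2)
      \<le> (\<Sum>k=1..T. lam k * inner (F (x k)) (x k - xstar))"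
    unfolding sum_distrib_left using mono lam_pos
    by (intro sum_mono) (simp add: mult.left_commute[of \<mu>])
  have sum0: "0 \<le> \<mu> * (\<Sum>k=1..T. lam k * (norm (x k - xstar))\<^sup>2)"
    using lam_pos mu_pos by (intro mult_nonneg_nonneg sum_nonneg) (auto intro: less_imp_le)
  have sum1: "0 \<le> (\<Sum>k=1..T. (norm (x k - v k))\<^sup>2)"
    by (intro sum_nonneg) simp
  have R2: "(norm (xstar - x0))\<^sup>2 \<le> R\<^sup>2"
    using R by (simp add: norm_minus_commute power_mono)
  note energy = viji_run_energy[OF run xstar]
  have "2 / \<mu> \<le> sum lam {1..T}"
    using energy mono' sum0 R2 by (intro sum_step_sizes_ge[OF run T0 T R0]) linarith
  then have "2 * (norm (xt - xstar))\<^sup>2 \<le> \<mu> * (sum lam {1..T} * (norm (xt - xstar))\<^sup>2)"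
    using mu_pos unfolding mult.assoc[symmetric]
    by (intro mult_right_mono) (simp_all add: field_simps)
  also have "\<dots> \<le> \<mu> * (\<Sum>k=1..T. lam k * (norm (x k - xstar))\<^sup>2)"
    unfolding xt using T0 lam_pos mu_pos
    by (intro mult_left_mono sum_weights_norm_mean_le sum_pos) (auto intro: less_imp_le)
  also have "\<dots> \<le> R\<^sup>2 / 2"
    using energy mono' sum1 R2 by linarith
  finally have "(norm (xt - xstar))\<^sup>2 \<le> (R / 2)\<^sup>2"
    by (simp add: power_divide)
  then show ?thesis
    by (rule power2_le_imp_le) (use R0 in simp)
qed

lemma viji_restarted_distance:
  assumes z: "viji_restarted 128 d X F J L1 \<mu> \<delta> \<epsilon> z"
    and "i \<le> restart_count (diameter X) \<epsilon>"
  shows "norm (z i - xstar) \<le> diameter X / 2 ^ i"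
  using assms(2)
proof (induction i)
  case 0
  then show ?case
    using z diameter_bounded_bound[OF bounded_X _ xstar, of "z 0"]
    by (simp add: viji_restarted_def dist_norm)
next
  case (Suc i)
  let ?R = "diameter X / 2 ^ i"
  let ?T = "inner_iters 128 (diameter X) L1 \<mu> \<delta> (Suc i)"
  have "0 \<le> ?R"
    by (simp add: diameter_ge_0 bounded_X)
  then have "(L1 * ?R / \<mu>) powr (2/3) = L1 powr (2/3) * ?R powr (2/3) / \<mu> powr (2/3)"
    using nonneg mu_pos by (simp add: powr_mult powr_divide)
  then have T: "128 * max ((L1 * ?R / \<mu>) powr (2/3)) (\<delta> / \<mu>) \<le> ?T"
    unfolding inner_iters_def Let_def by (simp del: times_divide_eq_right) linarith
  have "viji_output d X F J L1 \<delta> 10 (\<lambda>_. \<delta>) (z i) ?T (z (Suc i))"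
    using z Suc.prems unfolding viji_restarted_def
    by (metis One_nat_def atLeastAtMost_iff diff_Suc_1 le_add1 plus_1_eq_Suc)
  then have "norm (z (Suc i) - xstar) \<le> ?R / 2"
    using T Suc by (intro viji_output_halves_distance) auto
  then show ?case
    by (simp add: field_simps)
qed

end

section \<open>The total number of iterations\<close>

text \<open>
  Halving the radius multiplies its power \<open>2/3\<close> by \<open>(1/2) powr (2/3)\<close>, which is at most \<open>2/3\<close>
  because \<open>1/4 \<le> 8/27\<close>. The rational ratio keeps the constants of the geometric series simple. The
  index is shifted, so \<open>j\<close> is the number of halvings done before the restart.
\<close>

lemma inner_iters_le:
  assumes "0 \<le> c" "0 \<le> D" "0 \<le> L1" "0 < \<mu>" "0 \<le> \<delta>"
  shows "inner_iters c D L1 \<mu> \<delta> (Suc j)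
    \<le> c * (L1 * D / \<mu>) powr (2/3) * (2/3) ^ j + (c * (\<delta> / \<mu>) + 1)"
proof -
  let ?R = "D / 2 ^ j" and ?Q = "(L1 * D / \<mu>) powr (2/3)"
  have "(1 / 2 :: real) powr (2/3) \<le> 2/3"
  proof (rule power_le_imp_le_base[of _ 2])
    show "((1 / 2 :: real) powr (2/3)) ^ Suc 2 \<le> (2/3) ^ Suc 2"
      by (simp add: powr_power power_divide)
  qed simp
  then have "((1 / 2 :: real) powr (2/3)) ^ j \<le> (2/3) ^ j"
    by (intro power_mono) auto
  moreover have "(L1 * ?R / \<mu>) powr (2/3) = ?Q * ((1 / 2 :: real) powr (2/3)) ^ j"
  proof -
    have "L1 * ?R / \<mu> = L1 * D / \<mu> * (1/2) ^ j"
      by (simp add: power_divide)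
    moreover have "((1/2 :: real) ^ j) powr (2/3) = ((1/2) powr (2/3)) ^ j"
      by (simp add: powr_power powr_powr mult.commute powr_realpow[of "1/2", symmetric])
    ultimately show ?thesis
      using assms by (simp only: powr_mult)
  qed
  ultimately have Q: "(L1 * ?R / \<mu>) powr (2/3) \<le> ?Q * (2/3) ^ j"
    by (simp add: mult_left_mono)
  have "L1 powr (2/3) * ?R powr (2/3) / \<mu> powr (2/3) = (L1 * ?R / \<mu>) powr (2/3)"
    using assms by (simp add: powr_mult powr_divide)
  then have "inner_iters c D L1 \<mu> \<delta> (Suc j)
      = nat \<lceil>c * max ((L1 * ?R / \<mu>) powr (2/3)) (\<delta> / \<mu>)\<rceil>"
    by (simp add: inner_iters_def Let_def)
  also have "real \<dots> \<le> c * max ((L1 * ?R / \<mu>) powr (2/3)) (\<delta> / \<mu>) + 1"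
  proof -
    have "0 \<le> c * max ((L1 * ?R / \<mu>) powr (2/3)) (\<delta> / \<mu>)"
      using assms by (intro mult_nonneg_nonneg) (auto simp: max_def)
    then show ?thesis
      by linarith
  qed
  also have "\<dots> \<le> c * (?Q * (2/3) ^ j + \<delta> / \<mu>) + 1"
    using assms Q by (intro add_right_mono mult_left_mono) (auto simp: max_def intro: add_increasing add_increasing2)
  finally show ?thesis
    by (simp add: algebra_simps)
qed

lemma sum_inner_iters_le:
  assumes "1 \<le> c" "0 \<le> D" "0 \<le> L1" "0 < \<mu>" "0 \<le> \<delta>"
  shows "real (\<Sum>i=1..n. inner_iters c D L1 \<mu> \<delta> i)
    \<le> 3 * c * ((L1 * D / \<mu>) powr (2/3) + (\<delta> / \<mu> + 1) * n)"
proof -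
  let ?Q = "(L1 * D / \<mu>) powr (2/3)"
  have "real (\<Sum>i=1..n. inner_iters c D L1 \<mu> \<delta> i) = (\<Sum>j<n. real (inner_iters c D L1 \<mu> \<delta> (Suc j)))"
    by (simp add: sum.atLeast1_atMost_eq)
  also have "\<dots> \<le> (\<Sum>j<n. c * ?Q * (2/3) ^ j + (c * (\<delta> / \<mu>) + 1))"
    using assms by (intro sum_mono inner_iters_le) auto
  also have "\<dots> = c * ?Q * (3 * (1 - (2/3) ^ n)) + n * (c * (\<delta> / \<mu>) + 1)"
    by (simp add: sum.distrib sum_gp_strict flip: sum_distrib_left)
  also have "\<dots> \<le> c * ?Q * 3 + n * (3 * c * (\<delta> / \<mu> + 1))"
  proof (intro add_mono mult_left_mono)
    have "c * (\<delta> / \<mu>) + 1 \<le> c * (\<delta> / \<mu> + 1)"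
      using assms(1) by (simp add: distrib_left)
    also have "\<dots> \<le> 3 * c * (\<delta> / \<mu> + 1)"
      using assms by (intro mult_right_mono) auto
    finally show "c * (\<delta> / \<mu>) + 1 \<le> 3 * c * (\<delta> / \<mu> + 1)" .
  qed (use assms in auto)
  finally show ?thesis
    by (simp add: algebra_simps)
qed

section \<open>Convergence and complexity of VIJI-Restarted\<close>

text \<open>
  The inner counts use \<open>c = 128\<close>, the constant in \<open>sum_step_sizes_ge\<close>, and the geometric series
  with ratio \<open>2/3\<close> contributes a factor 3, whence \<open>C = 384\<close>.
\<close>

theorem theorem6p2:
  "\<exists>c>0. \<exists>C>0.
     \<forall>(d :: nat) (X :: rvec set) (F :: rvec \<Rightarrow> rvec) (DF :: rvec \<Rightarrow> nat \<Rightarrow> nat \<Rightarrow> real)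
       (J :: rvec \<Rightarrow> nat \<Rightarrow> nat \<Rightarrow> real) (L1 :: real) (\<mu> :: real) (\<delta> :: real) (\<epsilon> :: real)
       (xstar :: rvec).
       X \<subseteq> Rd d \<and> X \<noteq> {} \<and> closed X \<and> bounded X \<and> convex X \<and>
       F ` X \<subseteq> Rd d \<and> continuous_on X F \<and>
       (\<forall>x\<in>X. (F has_derivative matvec d (DF x)) (at x within X)) \<and>
       (\<forall>x\<in>X. \<forall>y\<in>X. matdiff_norm d (DF x) (DF y) \<le> L1 * norm (x - y)) \<and>
       \<mu> > 0 \<and>
       (\<forall>x\<in>X. \<forall>y\<in>X. inner (F x - F y) (x - y) \<ge> \<mu> * (norm (x - y))\<^sup>2) \<and>
       \<delta> \<ge> 0 \<and>
       (\<forall>v\<in>X. matdiff_norm d (DF v) (J v) \<le> \<delta>) \<and>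
       xstar \<in> X \<and> (\<forall>x\<in>X. inner (F xstar) (x - xstar) \<ge> 0) \<and>
       0 < \<epsilon> \<and> \<epsilon> \<le> diameter X
       \<longrightarrow>
       (\<forall>z. viji_restarted c d X F J L1 \<mu> \<delta> \<epsilon> z \<longrightarrow>
          norm (z (restart_count (diameter X) \<epsilon>) - xstar) \<le> \<epsilon>) \<and>
       real (\<Sum>i=1..restart_count (diameter X) \<epsilon>. inner_iters c (diameter X) L1 \<mu> \<delta> i)
         \<le> C * ((L1 * diameter X / \<mu>) powr (2/3)
                 + (\<delta> / \<mu> + 1) * real_of_int \<lceil>log 2 (diameter X / \<epsilon>)\<rceil>)"
proof (rule exI[of _ 128], rule conjI, simp, rule exI[of _ 384], rule conjI, simp,
    intro allI impI, elim conjE, rule conjI)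
  fix d X F DF J L1 \<mu> \<delta> \<epsilon> xstar
  assume cvx: "convex X" and bdd: "bounded X"
    and deriv: "\<forall>x\<in>X. (F has_derivative matvec d (DF x)) (at x within X)"
    and smooth: "\<forall>x\<in>X. \<forall>y\<in>X. matdiff_norm d (DF x) (DF y) \<le> L1 * norm (x - y)"
    and mu: "(0::real) < \<mu>"
    and mono: "\<forall>x\<in>X. \<forall>y\<in>X. \<mu> * (norm (x - y))\<^sup>2 \<le> inner (F x - F y) (x - y)"
    and delta: "(0::real) \<le> \<delta>" and inexact: "\<forall>v\<in>X. matdiff_norm d (DF v) (J v) \<le> \<delta>"
    and xstar: "xstar \<in> X" "\<forall>x\<in>X. 0 \<le> inner (F xstar) (x - xstar)"
    and eps: "0 < \<epsilon>" "\<epsilon> \<le> diameter X"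
  let ?D = "diameter X" and ?n = "restart_count (diameter X) \<epsilon>"
  have D: "0 < ?D"
    using eps by linarith
  \<comment> \<open>\<open>L1\<close> is nonnegative because \<open>X\<close> has two distinct points, at which the Lipschitz condition can
      be evaluated.\<close>
  obtain x y where xy: "x \<in> X" "y \<in> X" "x \<noteq> y"
    using diameter_lower_bounded[OF bdd, of "?D / 2"] D by force
  have "0 \<le> L1 * norm (x - y)"
    using order_trans[OF matdiff_norm_nonneg] smooth xy by blast
  then have L1: "0 \<le> L1"
    using xy by (simp add: zero_le_mult_iff)
  interpret strongly_monotone_vi d X F DF J L1 \<delta> \<mu> xstar
    using cvx bdd deriv smooth mu mono delta inexact xstar L1 by unfold_locales auto
  have log_nonneg: "0 \<le> log 2 (?D / \<epsilon>)"
    using eps by simp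
  then have n: "real ?n = \<lceil>log 2 (?D / \<epsilon>)\<rceil>"
    by (simp add: restart_count_def)
  show "\<forall>z. viji_restarted 128 d X F J L1 \<mu> \<delta> \<epsilon> z \<longrightarrow> norm (z ?n - xstar) \<le> \<epsilon>"
  proof (intro allI impI)
    fix z
    assume "viji_restarted 128 d X F J L1 \<mu> \<delta> \<epsilon> z"
    then have "norm (z ?n - xstar) \<le> ?D / 2 ^ ?n"
      by (rule viji_restarted_distance) simp
    also have "?D / \<epsilon> \<le> 2 ^ ?n"
    proof -
      have "log 2 (?D / \<epsilon>) \<le> ?n"
        using n by linarith
      then have "?D / \<epsilon> \<le> 2 powr ?n"
        using D eps by (subst (asm) log_le_iff) auto
      then show ?thesis
        by (simp add: powr_realpow)
    qed
    then have "?D / 2 ^ ?n \<le> \<epsilon>"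
      using eps by (simp add: field_simps)
    finally show "norm (z ?n - xstar) \<le> \<epsilon>" .
  qed
  show "real (\<Sum>i=1..?n. inner_iters 128 ?D L1 \<mu> \<delta> i)
      \<le> 384 * ((L1 * ?D / \<mu>) powr (2/3) + (\<delta> / \<mu> + 1) * real_of_int \<lceil>log 2 (?D / \<epsilon>)\<rceil>)"
    using sum_inner_iters_le[of 128 ?D L1 \<mu> \<delta> ?n] D L1 mu delta n by simp
qed

end
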